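(* Let $C$ be a nonempty closed convex subset of a real Hilbert space $H$ and $T$ a nonexpansive mapping of $C$ into itself such that $F(T)\ne\emptyset$. Let $\{\alpha_n\}_{n\ge0}$ and $\{\beta_n\}_{n\ge0}$ be real sequences with $0<\alpha\le\alpha_n\le1$ (for some constant $\alpha$) and $0\le\beta_n\le1$ for all $n$. Let $x_0\in C$ be arbitrary and let $\{x_n\}$ be given, for $n\ge0$, by $$v_n=(1-\alpha_n)x_n+\alpha_nTx_n,\qquad y_n=(1-\beta_n)x_n+\beta_nTv_n,$$ $$C_n'=\{z\in C:\|z-v_n\|\le\|z-x_n\|\},$$ $$C_n''=\{z\in C:\|z-y_n\|^2\le\|z-x_n\|^2+\beta_n(\|v_n\|^2-\|x_n\|^2+2\langle x_n-v_n,z\rangle)\},$$ $$C_n=C_n'\cap C_n'',$$ $$Q_n=\{z\in C:\langle z-x_n,x_n-x_0\rangle\ge0\},$$ $$x_{n+1}=P_{C_n^*\cap Q_n}x_0,$$ where $C_n^*$ is a closed convex set with $F(T)\subset C_n^*\subset C_n$. Then $\{x_n\}$ converges strongly to $P_{F(T)}x_0$.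
   Context: $F(T)=\{x\in C:Tx=x\}$. $T$ is nonexpansive if $\|Tx-Ty\|\le\|x-y\|$ for all $x,y\in C$. For a nonempty closed convex set $D\subset H$, $P_D$ is the metric projection (nearest-point map) onto $D$. *)

theory Defs
  imports "HOL-Analysis.Analysis"
begin

definition fixed_points :: "'a set \<Rightarrow> ('a \<Rightarrow> 'a) \<Rightarrow> 'a set"
  where "fixed_points C T = {x \<in> C. T x = x}"

definition nonexpansive_on :: "'a::real_normed_vector set \<Rightarrow> ('a \<Rightarrow> 'a) \<Rightarrow> bool"
  where "nonexpansive_on C T \<longleftrightarrow> (\<forall>x\<in>C. \<forall>y\<in>C. norm (T x - T y) \<le> norm (x - y))"

text \<open>
  The library's \<open>closest_point\<close> is restricted to \<open>heine_borel\<close> spaces, hence to finite dimension.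
  In a Hilbert space the description below is proper for every nonempty closed convex \<open>D\<close>;
  for other \<open>D\<close> the value may be unspecified.
\<close>

definition metric_proj :: "'a::real_normed_vector set \<Rightarrow> 'a \<Rightarrow> 'a"
  where "metric_proj D x = (THE p. p \<in> D \<and> (\<forall>z\<in>D. norm (x - p) \<le> norm (x - z)))"

end

theory Submission
  imports Defs
begin

text \<open>
  The sets \<open>Q n\<close> make the distances \<open>norm (x n - x 0)\<close> increase, and they never exceed
  the distance from \<open>x 0\<close> to the fixed point set \<open>F\<close>, because the construction never cuts away a
  fixed point. Hence consecutive iterates come together. As \<open>x (Suc n)\<close> lies in \<open>C' n\<close>, it is at
  least as close to \<open>v n\<close> as to \<open>x n\<close>, so \<open>x n\<close> and \<open>v n\<close> come together too, and because
  \<open>\<alpha>\<close> is bounded away from \<open>0\<close>, the residuals \<open>x n - T (x n)\<close> tend to \<open>0\<close>.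

  The usual way to finish combines weak compactness of bounded sets with the demiclosedness of
  \<open>I - T\<close>. Here both are replaced by a shrinking family of convex sets. The operator \<open>I - T\<close> is
  monotone, so by Minty's argument \<open>F\<close> is the set of all \<open>w \<in> C\<close> with
  \<open>0 \<le> inner (z - T z) (z - w)\<close> for every \<open>z \<in> C\<close>. Relaxing these linear inequalities by a
  small amount gives closed convex sets that decrease to \<open>F\<close>
  (\<open>Inter_relaxed_fixed_points\<close>) and that contain every bounded sequence in \<open>C\<close> with vanishing
  residual from some index on (\<open>eventually_in_relaxed_fixed_points\<close>).

  What remains is geometry (\<open>tendsto_metric_proj_Inter\<close>): a sequence that eventually enters each
  member of a decreasing family of closed convex sets, and is never farther from a point \<open>u\<close> than
  the intersection is, converges to the projection of \<open>u\<close> onto the intersection. The reason is the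
  parallelogram law, which makes every asymptotically minimizing sequence a Cauchy sequence
  (\<open>asymptotic_minimizers_converge\<close>); the same principle also yields the existence of
  projections.
\<close>

section \<open>Minimizing the distance over decreasing closed convex sets\<close>

text \<open>
  The midpoint of two points of \<open>K k\<close> lies in \<open>K k\<close>, so up to a small error its squared distance
  to \<open>u\<close> is at least \<open>s\<close>, while those of the two points are at most \<open>s\<close>. By the parallelogram law
  the two points are then close to each other. Squared distances keep the estimate linear in the
  error.
\<close>

lemma asymptotic_minimizers_converge:
  fixes K :: "nat \<Rightarrow> 'a::{real_inner, complete_space} set" and w :: "nat \<Rightarrow> 'a"
  assumes cl: "\<And>k. closed (K k)" and co: "\<And>k. convex (K k)"
    and ev: "\<And>k. eventually (\<lambda>n. w n \<in> K k) sequentially"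
    and lower: "\<And>e. 0 < e \<Longrightarrow> \<exists>k. \<forall>z\<in>K k. s - e \<le> (norm (z - u))\<^sup>2"
    and upper: "\<And>e. 0 < e \<Longrightarrow> eventually (\<lambda>n. (norm (w n - u))\<^sup>2 \<le> s + e) sequentially"
  obtains l where "w \<longlonglongrightarrow> l" "l \<in> (\<Inter>k. K k)" "(norm (l - u))\<^sup>2 \<le> s"
proof -
  have "Cauchy w"
  proof (rule metric_CauchyI)
    fix e :: real assume "0 < e"
    define d where "d = e\<^sup>2 / 16"
    have "0 < d" using \<open>0 < e\<close> by (simp add: d_def)
    obtain k where k: "\<And>z. z \<in> K k \<Longrightarrow> s - d \<le> (norm (z - u))\<^sup>2"
      using lower[OF \<open>0 < d\<close>] by blast
    obtain N where N: "\<And>n. n \<ge> N \<Longrightarrow> w n \<in> K k \<and> (norm (w n - u))\<^sup>2 \<le> s + d"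
      using eventually_conj[OF ev[of k] upper[OF \<open>0 < d\<close>]]
      unfolding eventually_sequentially by blast
    have "dist (w m) (w n) < e" if "m \<ge> N" "n \<ge> N" for m n
    proof -
      let ?c = "(1/2) *\<^sub>R w m + (1/2) *\<^sub>R w n"
      have "?c \<in> K k"
        using N that by (intro convexD[OF co]) auto
      moreover have "(norm (w m - w n))\<^sup>2
          = 2 * (norm (w m - u))\<^sup>2 + 2 * (norm (w n - u))\<^sup>2 - 4 * (norm (?c - u))\<^sup>2"
        unfolding power2_norm_eq_inner
        by (simp add: inner_diff_left inner_diff_right inner_add_left inner_add_right
            inner_commute field_simps)
      ultimately have "(norm (w m - w n))\<^sup>2 \<le> 8 * d"
        using N[OF that(1)] N[OF that(2)] k[of ?c] by linarith
      also have "\<dots> < e\<^sup>2"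
        using \<open>0 < e\<close> by (simp add: d_def)
      finally show ?thesis
        unfolding dist_norm using \<open>0 < e\<close> by (simp add: power2_less_imp_less)
    qed
    then show "\<exists>M. \<forall>m\<ge>M. \<forall>n\<ge>M. dist (w m) (w n) < e" by blast
  qed
  then obtain l where l: "w \<longlonglongrightarrow> l"
    using Cauchy_convergent_iff convergent_def by blast
  have "l \<in> K k" for k
    using Lim_in_closed_set[OF cl ev _ l] by simp
  moreover have "(norm (l - u))\<^sup>2 \<le> s"
  proof (rule field_le_epsilon)
    fix e :: real assume "0 < e"
    have "(\<lambda>n. (norm (w n - u))\<^sup>2) \<longlonglongrightarrow> (norm (l - u))\<^sup>2"
      by (intro tendsto_intros l)
    then show "(norm (l - u))\<^sup>2 \<le> s + e"
      by (rule tendsto_upperbound[OF _ upper[OF \<open>0 < e\<close>]]) simp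
  qed
  ultimately show thesis using that l by blast
qed

text \<open>
  The squared distances from \<open>u\<close> to the sets \<open>K k\<close> increase, and a point \<open>p\<close> of the intersection
  bounds them. Near-minimizers in \<open>K 0\<close>, \<open>K 1\<close>, \<open>\<dots>\<close> are therefore asymptotically minimizing for
  the supremum of these distances. Their limit shows that no distance is lost in passing to the
  intersection.
\<close>

lemma nearest_point_Inter_decseq:
  fixes K :: "nat \<Rightarrow> 'a::{real_inner, complete_space} set"
  assumes cl: "\<And>k. closed (K k)" and co: "\<And>k. convex (K k)" and dec: "decseq K"
    and p: "p \<in> (\<Inter>k. K k)"
  obtains q where "q \<in> (\<Inter>k. K k)"
    "\<And>e. 0 < e \<Longrightarrow> \<exists>k. \<forall>z\<in>K k. (norm (q - u))\<^sup>2 - e \<le> (norm (z - u))\<^sup>2"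
proof -
  define m where "m k = (INF z\<in>K k. (norm (z - u))\<^sup>2)" for k
  define s where "s = (SUP k. m k)"
  have bdd: "bdd_below ((\<lambda>z. (norm (z - u))\<^sup>2) ` K k)" for k
    by (rule bdd_belowI2[where m = 0]) simp
  have m_le: "m k \<le> (norm (z - u))\<^sup>2" if "z \<in> K k" for k z
    unfolding m_def using that by (rule cINF_lower[OF bdd])
  have "bdd_above (range m)"
    using m_le p by (intro bdd_aboveI2[where M = "(norm (p - u))\<^sup>2"]) auto
  then have m_le_s: "m k \<le> s" for k
    unfolding s_def by (rule cSUP_upper[OF UNIV_I])
  have "\<exists>z\<in>K k. (norm (z - u))\<^sup>2 < m k + inverse (real (Suc k))" for k
  proof -
    have "K k \<noteq> {}" using p by auto
    then show ?thesis
      using cINF_less_iff[OF _ bdd, of k "m k + inverse (real (Suc k))"]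
      by (simp add: m_def)
  qed
  then obtain w where w: "\<And>k. w k \<in> K k"
    "\<And>k. (norm (w k - u))\<^sup>2 < m k + inverse (real (Suc k))"
    by metis
  have lower: "\<exists>k. \<forall>z\<in>K k. s - e \<le> (norm (z - u))\<^sup>2" if "0 < e" for e
  proof -
    have "s - e < (SUP k. m k)" using that by (simp add: s_def)
    then obtain k where "s - e < m k"
      using less_cSUP_iff[OF _ \<open>bdd_above (range m)\<close>] by auto
    then show ?thesis using m_le by (meson less_imp_le order_trans)
  qed
  have ev: "eventually (\<lambda>n. w n \<in> K k) sequentially" for k
    unfolding eventually_sequentially using w(1) decseqD[OF dec] by blast
  have upper: "eventually (\<lambda>n. (norm (w n - u))\<^sup>2 \<le> s + e) sequentially" if "0 < e" for e
  proof -
    have "eventually (\<lambda>n. inverse (real (Suc n)) < e) sequentially"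
      using order_tendstoD(2)[OF LIMSEQ_inverse_real_of_nat that] .
    then show ?thesis
    proof eventually_elim
      case (elim n)
      show ?case using w(2)[of n] m_le_s[of n] elim by linarith
    qed
  qed
  obtain q where q: "q \<in> (\<Inter>k. K k)" "(norm (q - u))\<^sup>2 \<le> s"
    using asymptotic_minimizers_converge[of K w s u, OF cl co ev lower upper] by blast
  have "\<exists>k. \<forall>z\<in>K k. (norm (q - u))\<^sup>2 - e \<le> (norm (z - u))\<^sup>2" if "0 < e" for e
  proof -
    obtain k where "\<And>z. z \<in> K k \<Longrightarrow> s - e \<le> (norm (z - u))\<^sup>2"
      using lower[OF \<open>0 < e\<close>] by blast
    then show ?thesis using q(2) by (meson diff_right_mono order_trans)
  qed
  then show thesis using that q(1) by blast
qed

section \<open>The metric projection\<close>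

lemma metric_proj_eqI:
  fixes D :: "'a::real_inner set"
  assumes "closed D" "convex D" "p \<in> D" "\<And>z. z \<in> D \<Longrightarrow> norm (u - p) \<le> norm (u - z)"
  shows "metric_proj D u = p"
  unfolding metric_proj_def
proof (rule the_equality)
  show "q = p" if "q \<in> D \<and> (\<forall>z\<in>D. norm (u - q) \<le> norm (u - z))" for q
    using any_closest_point_unique[of D q p u] assms that by (simp add: dist_norm)
qed (use assms in blast)

text \<open>Existence is the case of a constant family in \<open>nearest_point_Inter_decseq\<close>.\<close>

lemma metric_proj_nearest:
  fixes D :: "'a::{real_inner, complete_space} set"
  assumes "closed D" "convex D" "D \<noteq> {}"
  shows metric_proj_in: "metric_proj D u \<in> D"
    and metric_proj_le: "z \<in> D \<Longrightarrow> norm (u - metric_proj D u) \<le> norm (u - z)"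
proof -
  obtain p where "p \<in> D" using assms by blast
  then obtain q where "q \<in> D"
    and q: "\<And>e. 0 < e \<Longrightarrow> \<forall>z\<in>D. (norm (q - u))\<^sup>2 - e \<le> (norm (z - u))\<^sup>2"
    using nearest_point_Inter_decseq[of "\<lambda>_. D" p u] assms by (auto simp: decseq_def)
  have "norm (u - q) \<le> norm (u - z)" if "z \<in> D" for z
  proof -
    have "(norm (q - u))\<^sup>2 \<le> (norm (z - u))\<^sup>2"
      by (rule field_le_epsilon) (use q that in \<open>simp add: diff_le_eq\<close>)
    then show ?thesis by (simp add: norm_minus_commute)
  qed
  moreover from this have "metric_proj D u = q"
    using assms \<open>q \<in> D\<close> by (intro metric_proj_eqI)
  ultimately show "metric_proj D u \<in> D"
    and "z \<in> D \<Longrightarrow> norm (u - metric_proj D u) \<le> norm (u - z)"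
    using \<open>q \<in> D\<close> by auto
qed

lemma metric_proj_inner_nonneg:
  fixes D :: "'a::{real_inner, complete_space} set"
  assumes "closed D" "convex D" "z \<in> D"
  shows "0 \<le> inner (z - metric_proj D u) (metric_proj D u - u)"
proof -
  have "D \<noteq> {}" using assms by blast
  note proj = metric_proj_in[OF assms(1,2) this] metric_proj_le[OF assms(1,2) this]
  have "inner (u - metric_proj D u) (z - metric_proj D u) \<le> 0"
    by (rule any_closest_point_dot) (use assms proj in \<open>auto simp: dist_norm\<close>)
  then show ?thesis
    by (metis inner_commute inner_minus_left minus_diff_eq neg_0_le_iff_le)
qed

text \<open>
  The distances from \<open>u\<close> to the sets \<open>K k\<close> tend to the distance from \<open>u\<close> to the intersection,
  so \<open>w\<close> is asymptotically minimizing. Its limit is a nearest point of the intersection, and there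
  is only one.
\<close>

lemma tendsto_metric_proj_Inter:
  fixes K :: "nat \<Rightarrow> 'a::{real_inner, complete_space} set"
  assumes cl: "\<And>k. closed (K k)" and co: "\<And>k. convex (K k)" and dec: "decseq K"
    and ne: "(\<Inter>k. K k) \<noteq> {}"
    and ev: "\<And>k. eventually (\<lambda>n. w n \<in> K k) sequentially"
    and le: "\<And>n p. p \<in> (\<Inter>k. K k) \<Longrightarrow> norm (w n - u) \<le> norm (p - u)"
  shows "w \<longlonglongrightarrow> metric_proj (\<Inter>k. K k) u"
proof -
  let ?F = "\<Inter>k. K k"
  obtain p where "p \<in> ?F" using ne by blast
  then obtain q where q: "q \<in> ?F"
    "\<And>e. 0 < e \<Longrightarrow> \<exists>k. \<forall>z\<in>K k. (norm (q - u))\<^sup>2 - e \<le> (norm (z - u))\<^sup>2"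
    using nearest_point_Inter_decseq[of K p u] cl co dec by blast
  have upper: "(norm (w n - u))\<^sup>2 \<le> (norm (q - u))\<^sup>2 + e" if "0 < e" for n e
    using power_mono[OF le[OF q(1), of n] norm_ge_zero, of 2] that by linarith
  obtain l where l: "w \<longlonglongrightarrow> l" "l \<in> ?F"
    by (rule asymptotic_minimizers_converge[of K w "(norm (q - u))\<^sup>2" u,
          OF cl co ev q(2) always_eventually]) (use upper in blast)+
  have "norm (u - l) \<le> norm (u - z)" if "z \<in> ?F" for z
  proof -
    have "(\<lambda>n. norm (w n - u)) \<longlonglongrightarrow> norm (l - u)"
      by (intro tendsto_intros l)
    then have "norm (l - u) \<le> norm (z - u)"
      by (rule LIMSEQ_le_const2) (use le that in blast)
    then show ?thesis by (simp add: norm_minus_commute)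
  qed
  then have "metric_proj ?F u = l"
    using l(2) cl co by (intro metric_proj_eqI closed_INT convex_INT) auto
  then show ?thesis using l(1) by simp
qed

section \<open>Relaxed fixed point sets of a nonexpansive map\<close>

text \<open>
  The slack grows with \<open>norm z\<close> because \<open>z\<close> ranges over all of \<open>C\<close>, which may be unbounded:
  a point with a small residual satisfies these inequalities only up to a multiple of
  \<open>norm (z - w)\<close>.
\<close>

definition relaxed_fixed_points :: "'a::real_inner set \<Rightarrow> ('a \<Rightarrow> 'a) \<Rightarrow> real \<Rightarrow> 'a set"
  where "relaxed_fixed_points C T d
    = {w \<in> C. \<forall>z\<in>C. - (d * (1 + norm z)) \<le> inner (z - T z) (z - w)}"

lemma relaxed_fixed_points_eq:
  "relaxed_fixed_points C T d
    = C \<inter> (\<Inter>z\<in>C. {w. inner (z - T z) w \<le> inner (z - T z) z + d * (1 + norm z)})"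
proof -
  have "- c \<le> inner b (z - w) \<longleftrightarrow> inner b w \<le> inner b z + c" for b z w :: 'a and c
    unfolding inner_diff_right by linarith
  then show ?thesis by (auto simp: relaxed_fixed_points_def)
qed

lemma closed_relaxed_fixed_points:
  "closed C \<Longrightarrow> closed (relaxed_fixed_points C T d)"
  unfolding relaxed_fixed_points_eq by (intro closed_Int closed_INT ballI closed_halfspace_le)

lemma convex_relaxed_fixed_points:
  "convex C \<Longrightarrow> convex (relaxed_fixed_points C T d)"
  unfolding relaxed_fixed_points_eq by (intro convex_Int convex_INT convex_halfspace_le)

lemma relaxed_fixed_points_mono:
  assumes "d \<le> e"
  shows "relaxed_fixed_points C T d \<subseteq> relaxed_fixed_points C T e"
proof -
  have "d * (1 + norm z) \<le> e * (1 + norm z)" for z :: 'a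
    using assms by (intro mult_right_mono) auto
  then have "- (e * (1 + norm z)) \<le> c" if "- (d * (1 + norm z)) \<le> c" for z :: 'a and c
    using that by (meson neg_le_iff_le order_trans)
  then show ?thesis by (auto simp: relaxed_fixed_points_def)
qed

lemma nonexpansive_residual_monotone:
  fixes C :: "'a::real_inner set"
  assumes "nonexpansive_on C T" "z \<in> C" "w \<in> C"
  shows "inner (w - T w) (z - w) \<le> inner (z - T z) (z - w)"
proof -
  have "inner (T z - T w) (z - w) \<le> norm (T z - T w) * norm (z - w)"
    by (rule norm_cauchy_schwarz)
  also have "\<dots> \<le> norm (z - w) * norm (z - w)"
    using assms by (intro mult_right_mono) (auto simp: nonexpansive_on_def)
  finally have "inner (T z - T w) (z - w) \<le> inner (z - w) (z - w)"
    by (simp add: dot_square_norm power2_eq_square)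
  then show ?thesis by (simp add: inner_diff_left)
qed

text \<open>
  Minty's argument for the hard direction: testing the inequality at the point
  \<open>z = w + t *\<^sub>R (T w - w)\<close> and dividing by \<open>t\<close> gives \<open>0 \<le> inner (z - T z) (T w - w)\<close>, and as
  \<open>t\<close> tends to \<open>0\<close> the right-hand side tends to \<open>- (norm (T w - w))\<^sup>2\<close>.
\<close>

lemma fixed_point_iff_variational:
  fixes C :: "'a::real_inner set"
  assumes "convex C" "T \<in> C \<rightarrow> C" "nonexpansive_on C T" "w \<in> C"
  shows "T w = w \<longleftrightarrow> (\<forall>z\<in>C. 0 \<le> inner (z - T z) (z - w))"
proof
  assume "T w = w"
  then show "\<forall>z\<in>C. 0 \<le> inner (z - T z) (z - w)"
    using nonexpansive_residual_monotone[OF assms(3) _ assms(4)] by fastforce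
next
  assume *: "\<forall>z\<in>C. 0 \<le> inner (z - T z) (z - w)"
  define t where "t n = inverse (real (Suc n))" for n
  define z where "z n = w + t n *\<^sub>R (T w - w)" for n
  have t: "0 < t n" "t n \<le> 1" for n
    by (auto simp: t_def inverse_le_1_iff)
  have z_in: "z n \<in> C" for n
  proof -
    have "z n = (1 - t n) *\<^sub>R w + t n *\<^sub>R T w"
      by (simp add: z_def algebra_simps)
    then show ?thesis
      using convexD[OF assms(1), of w "T w" "1 - t n" "t n"] t[of n] assms(2,4) by auto
  qed
  have "z \<longlonglongrightarrow> w + 0 *\<^sub>R (T w - w)"
    unfolding z_def t_def by (intro tendsto_intros LIMSEQ_inverse_real_of_nat)
  then have z: "z \<longlonglongrightarrow> w" by simp
  have Tz: "(\<lambda>n. T (z n)) \<longlonglongrightarrow> T w"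
  proof (rule LIM_zero_cancel, rule tendsto_0_le)
    show "(\<lambda>n. z n - w) \<longlonglongrightarrow> 0" using z by (rule LIM_zero)
    show "eventually (\<lambda>n. norm (T (z n) - T w) \<le> norm (z n - w) * 1) sequentially"
      using assms(3,4) z_in by (auto simp: nonexpansive_on_def)
  qed
  have "(\<lambda>n. inner (z n - T (z n)) (T w - w)) \<longlonglongrightarrow> inner (w - T w) (T w - w)"
    by (intro tendsto_intros z Tz)
  moreover have "0 \<le> inner (z n - T (z n)) (T w - w)" for n
  proof -
    have "0 \<le> t n * inner (z n - T (z n)) (T w - w)"
      using *[rule_format, OF z_in[of n]] by (simp add: z_def)
    then show ?thesis using t(1)[of n] by (simp add: zero_le_mult_iff)
  qed
  ultimately have "0 \<le> inner (w - T w) (T w - w)"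
    by (intro LIMSEQ_le_const) auto
  moreover have "inner (w - T w) (T w - w) = - (norm (T w - w))\<^sup>2"
    by (simp add: power2_norm_eq_inner inner_diff_left inner_diff_right)
  ultimately show "T w = w" by simp
qed

lemma Inter_relaxed_fixed_points:
  fixes C :: "'a::real_inner set"
  assumes "convex C" "T \<in> C \<rightarrow> C" "nonexpansive_on C T" "\<delta> \<longlonglongrightarrow> 0" "\<And>k. 0 \<le> \<delta> k"
  shows "(\<Inter>k. relaxed_fixed_points C T (\<delta> k)) = fixed_points C T"
proof (intro equalityI subsetI)
  fix w assume w: "w \<in> (\<Inter>k. relaxed_fixed_points C T (\<delta> k))"
  then have "w \<in> C" by (auto simp: relaxed_fixed_points_def)
  have "0 \<le> inner (z - T z) (z - w)" if "z \<in> C" for z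
  proof -
    have "(\<lambda>k. - (\<delta> k * (1 + norm z))) \<longlonglongrightarrow> - (0 * (1 + norm z))"
      by (intro tendsto_intros assms)
    then have "(\<lambda>k. - (\<delta> k * (1 + norm z))) \<longlonglongrightarrow> 0" by simp
    then show ?thesis
      by (rule LIMSEQ_le_const2) (use w that in \<open>auto simp: relaxed_fixed_points_def\<close>)
  qed
  then show "w \<in> fixed_points C T"
    using fixed_point_iff_variational[OF assms(1-3)] \<open>w \<in> C\<close> by (auto simp: fixed_points_def)
next
  fix w assume "w \<in> fixed_points C T"
  then have w: "w \<in> C" "\<And>z. z \<in> C \<Longrightarrow> 0 \<le> inner (z - T z) (z - w)"
    using fixed_point_iff_variational[OF assms(1-3)] by (auto simp: fixed_points_def)
  have "- (\<delta> k * (1 + norm z)) \<le> inner (z - T z) (z - w)" if "z \<in> C" for k z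
  proof -
    have "0 \<le> \<delta> k * (1 + norm z)" using assms(5)[of k] by simp
    then show ?thesis using w(2)[OF that] by linarith
  qed
  then show "w \<in> (\<Inter>k. relaxed_fixed_points C T (\<delta> k))"
    using w(1) by (simp add: relaxed_fixed_points_def)
qed

text \<open>
  This replaces demiclosedness: by monotonicity and the Cauchy-Schwarz inequality, \<open>x n\<close> violates
  the inequalities characterizing fixed points by at most
  \<open>norm (x n - T (x n)) * norm (z - x n)\<close>.
\<close>

lemma eventually_in_relaxed_fixed_points:
  fixes C :: "'a::real_inner set"
  assumes "nonexpansive_on C T" and xC: "\<And>n. x n \<in> C"
    and bdd: "\<And>n. norm (x n) \<le> M"
    and res: "(\<lambda>n. x n - T (x n)) \<longlonglongrightarrow> 0" and "0 < d"
  shows "eventually (\<lambda>n. x n \<in> relaxed_fixed_points C T d) sequentially"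
proof -
  have "0 \<le> M" using bdd[of 0] norm_ge_zero order_trans by blast
  have "(\<lambda>n. norm (x n - T (x n)) * (1 + M)) \<longlonglongrightarrow> norm (0::'a) * (1 + M)"
    by (intro tendsto_intros res)
  then have "eventually (\<lambda>n. norm (x n - T (x n)) * (1 + M) < d) sequentially"
    using \<open>0 < d\<close> by (simp add: order_tendstoD(2))
  then show ?thesis
  proof eventually_elim
    case (elim n)
    have "- (d * (1 + norm z)) \<le> inner (z - T z) (z - x n)" if "z \<in> C" for z
    proof -
      have "norm (z - x n) \<le> norm z + M"
        using norm_triangle_ineq4[of z "x n"] bdd[of n] by linarith
      also have "\<dots> \<le> (1 + M) * (1 + norm z)"
        using \<open>0 \<le> M\<close> by (simp add: algebra_simps)
      finally have "norm (x n - T (x n)) * norm (z - x n)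
          \<le> norm (x n - T (x n)) * ((1 + M) * (1 + norm z))"
        by (rule mult_left_mono) simp
      also have "\<dots> \<le> d * (1 + norm z)"
        unfolding mult.assoc[symmetric] using elim by (intro mult_right_mono) auto
      finally have "- (d * (1 + norm z)) \<le> inner (x n - T (x n)) (z - x n)"
        using Cauchy_Schwarz_ineq2[of "x n - T (x n)" "z - x n"] by linarith
      also have "\<dots> \<le> inner (z - T z) (z - x n)"
        using nonexpansive_residual_monotone[OF assms(1) that xC] .
      finally show ?thesis .
    qed
    then show ?case using xC by (simp add: relaxed_fixed_points_def)
  qed
qed

section \<open>Strong convergence of the hybrid iteration\<close>

text \<open>
  The angle at \<open>x n\<close> between \<open>u\<close> and \<open>x (Suc n)\<close> is at least a right one, so Pythagoras' theorem
  becomes an inequality. The squared steps are then bounded by the increments of a bounded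
  increasing sequence.
\<close>

lemma obtuse_steps_vanish:
  fixes x :: "nat \<Rightarrow> 'a::real_inner"
  assumes obt: "\<And>n. 0 \<le> inner (x (Suc n) - x n) (x n - u)"
    and bdd: "\<And>n. norm (x n - u) \<le> M"
  shows "(\<lambda>n. norm (x (Suc n) - x n)) \<longlonglongrightarrow> 0"
proof -
  define g where "g n = (norm (x n - u))\<^sup>2" for n
  have step: "(norm (x (Suc n) - x n))\<^sup>2 \<le> g (Suc n) - g n" for n
  proof -
    have "g (Suc n) = g n + (norm (x (Suc n) - x n))\<^sup>2 + 2 * inner (x (Suc n) - x n) (x n - u)"
      unfolding g_def power2_norm_eq_inner
      by (simp add: inner_diff_left inner_diff_right inner_commute algebra_simps)
    then show ?thesis using obt[of n] by linarith
  qed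
  have "incseq g"
  proof (rule incseq_SucI)
    show "g n \<le> g (Suc n)" for n
      using step[of n] zero_le_power2[of "norm (x (Suc n) - x n)"] by linarith
  qed
  moreover have "g n \<le> M\<^sup>2" for n
    unfolding g_def by (rule power_mono[OF bdd]) simp
  ultimately obtain L where L: "g \<longlonglongrightarrow> L"
    using incseq_convergent by blast
  have "(\<lambda>n. g (Suc n) - g n) \<longlonglongrightarrow> L - L"
    by (rule tendsto_diff[OF LIMSEQ_Suc[OF L] L])
  then have "(\<lambda>n. g (Suc n) - g n) \<longlonglongrightarrow> 0" by simp
  then have "(\<lambda>n. (norm (x (Suc n) - x n))\<^sup>2) \<longlonglongrightarrow> 0"
    by (rule tendsto_sandwich[OF always_eventually always_eventually tendsto_const, rotated 2])
      (use step in simp_all)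
  then have "(\<lambda>n. sqrt ((norm (x (Suc n) - x n))\<^sup>2)) \<longlonglongrightarrow> sqrt 0"
    by (rule tendsto_real_sqrt)
  then show ?thesis by simp
qed

theorem theorem6p8:
  fixes C :: "'a::{real_inner, complete_space} set"
    and T :: "'a \<Rightarrow> 'a"
    and a :: real
    and \<alpha> \<beta> :: "nat \<Rightarrow> real"
    and x v y :: "nat \<Rightarrow> 'a"
    and C' C'' Cn Cstar Q :: "nat \<Rightarrow> 'a set"
  assumes "C \<noteq> {}" and "closed C" and "convex C"
    and "T \<in> C \<rightarrow> C" and "nonexpansive_on C T"
    and "fixed_points C T \<noteq> {}"
    and "0 < a" and "\<And>n. a \<le> \<alpha> n" and "\<And>n. \<alpha> n \<le> 1"
    and "\<And>n. 0 \<le> \<beta> n" and "\<And>n. \<beta> n \<le> 1"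
    and "x 0 \<in> C"
    and "\<And>n. v n = (1 - \<alpha> n) *\<^sub>R x n + \<alpha> n *\<^sub>R T (x n)"
    and "\<And>n. y n = (1 - \<beta> n) *\<^sub>R x n + \<beta> n *\<^sub>R T (v n)"
    and "\<And>n. C' n = {z \<in> C. norm (z - v n) \<le> norm (z - x n)}"
    and "\<And>n. C'' n = {z \<in> C. (norm (z - y n))\<^sup>2 \<le> (norm (z - x n))\<^sup>2
                 + \<beta> n * ((norm (v n))\<^sup>2 - (norm (x n))\<^sup>2 + 2 * inner (x n - v n) z)}"
    and "\<And>n. Cn n = C' n \<inter> C'' n"
    and "\<And>n. Q n = {z \<in> C. inner (z - x n) (x n - x 0) \<ge> 0}"
    and "\<And>n. closed (Cstar n)" and "\<And>n. convex (Cstar n)"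
    and "\<And>n. fixed_points C T \<subseteq> Cstar n" and "\<And>n. Cstar n \<subseteq> Cn n"
    and "\<And>n. x (Suc n) = metric_proj (Cstar n \<inter> Q n) (x 0)"
  shows "x \<longlonglongrightarrow> metric_proj (fixed_points C T) (x 0)"
proof -
  let ?F = "fixed_points C T"
  note T = \<open>T \<in> C \<rightarrow> C\<close> \<open>nonexpansive_on C T\<close>
  note Cn_def = \<open>\<And>n. Cn n = C' n \<inter> C'' n\<close>
  note C'_def = \<open>\<And>n. C' n = {z \<in> C. norm (z - v n) \<le> norm (z - x n)}\<close>
  note Q_def = \<open>\<And>n. Q n = {z \<in> C. inner (z - x n) (x n - x 0) \<ge> 0}\<close>
  note v_def = \<open>\<And>n. v n = (1 - \<alpha> n) *\<^sub>R x n + \<alpha> n *\<^sub>R T (x n)\<close>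
  note F_Cstar = \<open>\<And>n. ?F \<subseteq> Cstar n\<close>
  note x_Suc = \<open>\<And>n. x (Suc n) = metric_proj (Cstar n \<inter> Q n) (x 0)\<close>
  have Cstar_C': "Cstar n \<subseteq> C' n" for n
    using \<open>\<And>n. Cstar n \<subseteq> Cn n\<close>[of n] Cn_def by blast
  have Q_eq: "Q n = C \<inter> {z. inner (x n - x 0) (x n) \<le> inner (x n - x 0) z}" for n
    by (auto simp: Q_def inner_diff_left inner_commute)
  have cl: "closed (Cstar n \<inter> Q n)" for n
    unfolding Q_eq by (intro closed_Int closed_halfspace_ge assms)
  have co: "convex (Cstar n \<inter> Q n)" for n
    unfolding Q_eq by (intro convex_Int convex_halfspace_ge assms)
  \<comment> \<open>By induction \<open>x (Suc n)\<close> is the projection of \<open>x 0\<close> onto a convex set containing \<open>?F\<close>;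
      the variational inequality of this projection, tested on \<open>?F\<close>, is membership in
      \<open>Q (Suc n)\<close>.\<close>
  have F_Q: "?F \<subseteq> Q n" for n
  proof (induction n)
    case 0
    show ?case by (auto simp: Q_def fixed_points_def)
  next
    case (Suc n)
    show ?case
    proof
      fix p assume p: "p \<in> ?F"
      then have "p \<in> Cstar n \<inter> Q n" using Suc F_Cstar by blast
      then have "0 \<le> inner (p - x (Suc n)) (x (Suc n) - x 0)"
        unfolding x_Suc by (intro metric_proj_inner_nonneg cl co)
      then show "p \<in> Q (Suc n)"
        using p by (simp add: Q_def fixed_points_def)
    qed
  qed
  have F_CQ: "?F \<subseteq> Cstar n \<inter> Q n" for n
    using F_Cstar F_Q by blast
  have x_CQ: "x (Suc n) \<in> Cstar n \<inter> Q n" for n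
    unfolding x_Suc using F_CQ[of n] \<open>?F \<noteq> {}\<close> by (intro metric_proj_in cl co) auto
  have xC: "x n \<in> C" for n
    using \<open>x 0 \<in> C\<close> x_CQ by (cases n) (auto simp: Q_def)
  have dist_le: "norm (x n - x 0) \<le> norm (p - x 0)" if "p \<in> ?F" for n p
  proof (cases n)
    case (Suc m)
    have "p \<in> Cstar m \<inter> Q m" using that F_CQ by blast
    then have "norm (x 0 - x (Suc m)) \<le> norm (x 0 - p)"
      unfolding x_Suc by (intro metric_proj_le cl co) auto
    then show ?thesis using Suc by (simp add: norm_minus_commute)
  qed simp
  obtain p where p: "p \<in> ?F" using \<open>?F \<noteq> {}\<close> by blast
  have steps: "(\<lambda>n. norm (x (Suc n) - x n)) \<longlonglongrightarrow> 0"
  proof (rule obtuse_steps_vanish)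
    show "0 \<le> inner (x (Suc n) - x n) (x n - x 0)" for n
      using x_CQ[of n] by (simp add: Q_def)
    show "norm (x n - x 0) \<le> norm (p - x 0)" for n
      using dist_le[OF p] .
  qed
  \<comment> \<open>\<open>v n\<close> is no farther from \<open>x (Suc n)\<close> than \<open>x n\<close> is, whence the factor \<open>2\<close>; dividing by
      \<open>\<alpha> n \<ge> a\<close> turns \<open>x n - v n\<close> into the residual.\<close>
  have residual_le: "norm (x n - T (x n)) \<le> norm (x (Suc n) - x n) * (2 / a)" for n
  proof -
    have "norm (x (Suc n) - v n) \<le> norm (x (Suc n) - x n)"
      using x_CQ[of n] Cstar_C' by (auto simp: C'_def)
    then have "norm (x n - v n) \<le> 2 * norm (x (Suc n) - x n)"
      using norm_triangle_ineq4[of "x (Suc n) - v n" "x (Suc n) - x n"] by simp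
    moreover have "x n - v n = \<alpha> n *\<^sub>R (x n - T (x n))"
      by (simp add: v_def algebra_simps)
    moreover have "a * norm (x n - T (x n)) \<le> \<alpha> n * norm (x n - T (x n))"
      using \<open>a \<le> \<alpha> n\<close> by (intro mult_right_mono) auto
    moreover have "0 < \<alpha> n" using \<open>0 < a\<close> \<open>a \<le> \<alpha> n\<close> by linarith
    ultimately have "a * norm (x n - T (x n)) \<le> 2 * norm (x (Suc n) - x n)"
      by simp
    then show ?thesis using \<open>0 < a\<close> by (simp add: field_simps)
  qed
  have residual: "(\<lambda>n. x n - T (x n)) \<longlonglongrightarrow> 0"
    by (rule tendsto_0_le[OF steps, of _ "2 / a"]) (use residual_le in simp)
  have x_bdd: "norm (x n) \<le> norm (p - x 0) + norm (x 0)" for n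
    using norm_triangle_sub[of "x n" "x 0"] dist_le[OF p, of n] by linarith
  define K where "K k = relaxed_fixed_points C T (inverse (real (Suc k)))" for k
  have K_Inter: "(\<Inter>k. K k) = ?F"
    unfolding K_def using \<open>convex C\<close> T LIMSEQ_inverse_real_of_nat
    by (rule Inter_relaxed_fixed_points) simp
  have "x \<longlonglongrightarrow> metric_proj (\<Inter>k. K k) (x 0)"
  proof (rule tendsto_metric_proj_Inter)
    show "closed (K k)" "convex (K k)" for k
      unfolding K_def using \<open>closed C\<close> \<open>convex C\<close>
      by (auto intro: closed_relaxed_fixed_points convex_relaxed_fixed_points)
    show "decseq K"
      unfolding K_def by (intro decseq_SucI relaxed_fixed_points_mono) (simp add: field_simps)
    show "eventually (\<lambda>n. x n \<in> K k) sequentially" for k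
      unfolding K_def using T(2) xC x_bdd residual
      by (rule eventually_in_relaxed_fixed_points) simp
  qed (use K_Inter \<open>?F \<noteq> {}\<close> dist_le in auto)
  then show ?thesis by (simp only: K_Inter)
qed

end
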